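(* Let $(X,d)$ be a compact metric space with $\operatorname{diam}(X)\le1$ and let $Y$ be a closed subset of $X$, equipped with the restricted metric $d$. Then $R(Y,d)\le R(X,d)$.
   Context: Logarithmic ratio. A clopen partition of a compact metric space $(X,d)$ is a finite partition $\alpha=\{A_1,\dots,A_n\}$ of $X$ into nonempty clopen sets. Its diameter is $\delta(\alpha)=\max_i \operatorname{diam}(A_i)$ (and $\delta(\alpha)=0$ if $n=0$). Its gap is $\gamma(\alpha)=\min\{d(x,y): x\in A_i,\ y\in A_j,\ i\ne j\}$ if $n>1$, and $\gamma(\alpha)=\operatorname{diam}(X)$ if $n\le 1$ (with $\operatorname{diam}(\emptyset)=0$). Its logarithmic ratio $R(\alpha)\in[0,\infty]$ is $R(\alpha)=\log\gamma(\alpha)/\log\delta(\alpha)$ if $0<\delta(\alpha)<1$ and $\gamma(\alpha)<1$; $R(\alpha)=0$ if $\delta(\alpha)=0$; and $R(\alpha)=+\infty$ if either $0<\delta(\alpha)<1$ and $\gamma(\alpha)\ge 1$, or $\delta(\alpha)\ge 1$. The logarithmic ratio of $(X,d)$ is $$R(X,d)=\lim_{r\to 0^+}\inf\{R(\alpha): \alpha \text{ is a clopen partition of } X \text{ with } \delta(\alpha)<r\}\in[0,\infty],$$ with $\inf\emptyset=+\infty$. *)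

theory Defs
  imports "HOL-Analysis.Analysis"
begin

text \<open>
  A metric space \<open>(X,d)\<close> is represented as a subset \<open>X\<close> of a type of class
  \<open>metric_space\<close>, with \<open>d\<close> the restriction of \<^const>\<open>dist\<close> to \<open>X\<close>. All topological
  notions are taken relative to \<open>X\<close>, so only distances between points of \<open>X\<close> matter,
  and for \<open>Y \<subseteq> X\<close> the same definitions applied to \<open>Y\<close> speak about the restricted metric.
\<close>

definition clopen_partition :: "'a::metric_space set \<Rightarrow> 'a set set \<Rightarrow> bool" where
  "clopen_partition X \<alpha> \<longleftrightarrow>
     finite \<alpha> \<and> partition_on X \<alpha> \<and>
     (\<forall>A\<in>\<alpha>. openin (top_of_set X) A \<and> closedin (top_of_set X) A)"

definition part_diam :: "'a::metric_space set set \<Rightarrow> real" where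
  "part_diam \<alpha> = (if \<alpha> = {} then 0 else Max (diameter ` \<alpha>))"

text \<open>
  The infimum below is a minimum for clopen partitions of compact spaces,
  see \<open>part_gap_attained\<close>.
\<close>

definition part_gap :: "'a::metric_space set \<Rightarrow> 'a set set \<Rightarrow> real" where
  "part_gap X \<alpha> =
     (if card \<alpha> > 1
      then Inf {dist x y | x y A B. A \<in> \<alpha> \<and> B \<in> \<alpha> \<and> A \<noteq> B \<and> x \<in> A \<and> y \<in> B}
      else diameter X)"

definition part_log_ratio :: "'a::metric_space set \<Rightarrow> 'a set set \<Rightarrow> ereal" where
  "part_log_ratio X \<alpha> =
     (if part_diam \<alpha> = 0 then 0
      else if part_diam \<alpha> < 1 \<and> part_gap X \<alpha> < 1
      then ereal (ln (part_gap X \<alpha>) / ln (part_diam \<alpha>))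
      else \<infinity>)"

text \<open>The infimum of the empty set in \<^typ>\<open>ereal\<close> is \<open>\<infinity>\<close>.\<close>

definition log_ratio_below :: "'a::metric_space set \<Rightarrow> real \<Rightarrow> ereal" where
  "log_ratio_below X r =
     Inf {part_log_ratio X \<alpha> | \<alpha>. clopen_partition X \<alpha> \<and> part_diam \<alpha> < r}"

text \<open>The limit exists by monotonicity, see \<open>log_ratio_tendsto\<close>.\<close>

definition log_ratio :: "'a::metric_space set \<Rightarrow> ereal" where
  "log_ratio X = Lim (at_right 0) (log_ratio_below X)"

lemma part_gap_attained:
  fixes X :: "'a::metric_space set"
  assumes "compact X" "clopen_partition X \<alpha>" "card \<alpha> > 1"
  shows "\<exists>A\<in>\<alpha>. \<exists>B\<in>\<alpha>. A \<noteq> B \<and> (\<exists>x\<in>A. \<exists>y\<in>B. part_gap X \<alpha> = dist x y)"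
proof -
  define S where "S = {(A, B). A \<in> \<alpha> \<and> B \<in> \<alpha> \<and> A \<noteq> B}"
  define K where "K = (\<Union>(A, B)\<in>S. A \<times> B)"
  have K_iff: "q \<in> K \<longleftrightarrow> (\<exists>A B. A \<in> \<alpha> \<and> B \<in> \<alpha> \<and> A \<noteq> B \<and> fst q \<in> A \<and> snd q \<in> B)" for q
    unfolding K_def S_def by (simp add: mem_Times_iff split_beta)
  have fin: "finite \<alpha>" and ne: "{} \<notin> \<alpha>"
    and cl: "\<And>A. A \<in> \<alpha> \<Longrightarrow> closedin (top_of_set X) A"
    using assms(2) by (auto simp: clopen_partition_def partition_on_def)
  have "finite S"
    by (rule finite_subset[of _ "\<alpha> \<times> \<alpha>"]) (auto simp: S_def fin)
  moreover have "compact A" if "A \<in> \<alpha>" for A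
    using closedin_compact[OF assms(1) cl[OF that]] .
  ultimately have "compact K"
    unfolding K_def by (intro compact_UN) (auto simp: S_def intro: compact_Times)
  obtain A B where "A \<in> \<alpha>" "B \<in> \<alpha>" "A \<noteq> B"
    using assms(3) fin by (metis One_nat_def card_le_Suc0_iff_eq not_less)
  moreover from this obtain x y where "x \<in> A" "y \<in> B"
    using ne by (metis ex_in_conv)
  ultimately have "(x, y) \<in> K"
    unfolding K_def S_def by auto
  then have "K \<noteq> {}"
    by blast
  have "continuous_on K (\<lambda>p. dist (fst p) (snd p))"
    by (intro continuous_intros)
  then obtain p where p: "p \<in> K" "\<And>q. q \<in> K \<Longrightarrow> dist (fst p) (snd p) \<le> dist (fst q) (snd q)"
    using continuous_attains_inf[OF \<open>compact K\<close> \<open>K \<noteq> {}\<close>] by blast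
  have "{dist x y | x y A B. A \<in> \<alpha> \<and> B \<in> \<alpha> \<and> A \<noteq> B \<and> x \<in> A \<and> y \<in> B}
        = (\<lambda>p. dist (fst p) (snd p)) ` K" (is "?L = ?R")
  proof
    show "?L \<subseteq> ?R"
    proof
      fix z assume "z \<in> ?L"
      then obtain x y A B where "z = dist x y" "A \<in> \<alpha>" "B \<in> \<alpha>" "A \<noteq> B" "x \<in> A" "y \<in> B"
        by blast
      then show "z \<in> ?R"
        by (intro image_eqI[of _ _ "(x, y)"]) (auto simp: K_def S_def)
    qed
    show "?R \<subseteq> ?L"
    proof
      fix z assume "z \<in> ?R"
      then obtain x y A B where "z = dist x y" "A \<in> \<alpha>" "B \<in> \<alpha>" "A \<noteq> B" "x \<in> A" "y \<in> B"
        using K_iff by blast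
      then show "z \<in> ?L"
        by blast
    qed
  qed
  then have "part_gap X \<alpha> = Inf ((\<lambda>p. dist (fst p) (snd p)) ` K)"
    using assms(3) by (simp add: part_gap_def)
  also have "\<dots> = dist (fst p) (snd p)"
    using p by (intro cInf_eq_minimum) auto
  finally have gap: "part_gap X \<alpha> = dist (fst p) (snd p)" .
  obtain A B where "A \<in> \<alpha>" "B \<in> \<alpha>" "A \<noteq> B" "fst p \<in> A" "snd p \<in> B"
    using p(1) K_iff by blast
  then show ?thesis
    using gap by blast
qed

lemma log_ratio_tendsto:
  "(log_ratio_below X \<longlongrightarrow> log_ratio X) (at_right 0)"
proof -
  have mono: "log_ratio_below X s \<le> log_ratio_below X r" if "r \<le> s" for r s
    unfolding log_ratio_below_def using that by (intro Inf_superset_mono) auto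
  have "(log_ratio_below X \<longlongrightarrow> (SUP r\<in>{0<..}. log_ratio_below X r)) (at_right 0)"
  proof (rule order_tendstoI)
    fix a assume "a < (SUP r\<in>{0<..}. log_ratio_below X r)"
    then obtain r where r: "r > 0" "a < log_ratio_below X r"
      by (auto simp: less_SUP_iff)
    have "a < log_ratio_below X s" if "0 < s" "s < r" for s
      using r(2) mono[of s r] that by simp
    then show "\<forall>\<^sub>F s in at_right 0. a < log_ratio_below X s"
      using r(1) by (auto simp: eventually_at_right_field)
  next
    fix a assume a: "(SUP r\<in>{0<..}. log_ratio_below X r) < a"
    have "log_ratio_below X s < a" if "0 < s" for s
      using a that by (meson SUP_upper greaterThan_iff le_less_trans)
    then show "\<forall>\<^sub>F s in at_right 0. log_ratio_below X s < a"
      by (auto simp: eventually_at_right_field intro: exI[of _ 1])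
  qed
  then show ?thesis
    unfolding log_ratio_def by (metis tendsto_Lim trivial_limit_at_right_real)
qed

end

theory Submission
  imports Defs
begin

text \<open>
  Restricting a clopen partition of \<open>X\<close> to \<open>Y\<close> can only decrease the diameter and, as long as
  at least two blocks meet \<open>Y\<close>, increase the gap, so it decreases the ratio of logarithms. What may go
  wrong is that only one block survives or that the gap reaches 1. If \<open>Y\<close> contains distinct points
  \<open>p\<close>, \<open>q\<close> with \<open>dist p q < 1\<close>, then partitions of diameter below \<open>dist p q\<close> separate them, which
  excludes both. If there are no such points, then partitions of \<open>Y\<close> of diameter below 1 have
  diameter 0 and hence ratio 0.
\<close>

section \<open>Traces of clopen partitions on a subset\<close>

definition restrict_partition :: "'a set \<Rightarrow> 'a set set \<Rightarrow> 'a set set" where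
  "restrict_partition Y \<alpha> = (\<inter>) Y ` \<alpha> - {{}}"

lemma restrict_partitionE:
  assumes "B \<in> restrict_partition Y \<alpha>"
  obtains A where "A \<in> \<alpha>" "B = Y \<inter> A" "B \<noteq> {}"
  using assms by (auto simp: restrict_partition_def)

text \<open>Traces of clopen sets are clopen in the subspace topology, and discarding empty traces
  keeps all blocks nonempty.\<close>

lemma clopen_partition_restrict:
  assumes "clopen_partition X \<alpha>" "Y \<subseteq> X"
  shows "clopen_partition Y (restrict_partition Y \<alpha>)"
  unfolding clopen_partition_def
proof (intro conjI ballI)
  show "finite (restrict_partition Y \<alpha>)"
    using assms(1) by (simp add: clopen_partition_def restrict_partition_def)
  show "partition_on Y (restrict_partition Y \<alpha>)"
    using partition_on_restrict[of X \<alpha> Y] assms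
    by (simp add: clopen_partition_def restrict_partition_def Int_absorb2)
next
  fix B assume "B \<in> restrict_partition Y \<alpha>"
  then obtain A where A: "A \<in> \<alpha>" "B = Y \<inter> A"
    by (rule restrict_partitionE)
  then have "openin (top_of_set X) A" "closedin (top_of_set X) A"
    using assms(1) by (auto simp: clopen_partition_def)
  then show "openin (top_of_set Y) B" "closedin (top_of_set Y) B"
    using assms(2) A(2)
    by (auto simp: openin_open closedin_closed)
qed

section \<open>Diameters of clopen partitions\<close>

lemma clopen_partition_bounded:
  assumes "compact X" "clopen_partition X \<alpha>" "A \<in> \<alpha>"
  shows "bounded A"
  using assms by (meson bounded_subset clopen_partition_def closedin_imp_subset compact_imp_bounded)

lemma diameter_le_part_diam:
  assumes "clopen_partition X \<alpha>" "A \<in> \<alpha>"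
  shows "diameter A \<le> part_diam \<alpha>"
  using assms by (auto simp: clopen_partition_def part_diam_def)

text \<open>The hypothesis \<open>0 \<le> c\<close> covers the empty partition, whose diameter is 0
  by convention.\<close>

lemma part_diam_le:
  assumes "clopen_partition X \<alpha>" "0 \<le> c" "\<And>A. A \<in> \<alpha> \<Longrightarrow> diameter A \<le> c"
  shows "part_diam \<alpha> \<le> c"
  using assms by (auto simp: clopen_partition_def part_diam_def)

lemma part_diam_nonneg:
  assumes "compact X" "clopen_partition X \<alpha>"
  shows "0 \<le> part_diam \<alpha>"
proof (cases "\<alpha> = {}")
  case False
  then obtain A where "A \<in> \<alpha>"
    by blast
  then show ?thesis
    using diameter_le_part_diam[OF assms(2)] diameter_ge_0[OF clopen_partition_bounded[OF assms]]
    by (meson order_trans)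
qed (simp add: part_diam_def)

lemma part_diam_restrict_le:
  assumes "compact X" "clopen_partition X \<alpha>" "Y \<subseteq> X"
  shows "part_diam (restrict_partition Y \<alpha>) \<le> part_diam \<alpha>"
proof (rule part_diam_le[OF clopen_partition_restrict[OF assms(2,3)] part_diam_nonneg[OF assms(1,2)]])
  fix B assume "B \<in> restrict_partition Y \<alpha>"
  then obtain A where A: "A \<in> \<alpha>" "B = Y \<inter> A"
    by (rule restrict_partitionE)
  then have "diameter B \<le> diameter A"
    using clopen_partition_bounded[OF assms(1,2)] by (intro diameter_subset) auto
  then show "diameter B \<le> part_diam \<alpha>"
    using diameter_le_part_diam[OF assms(2) A(1)] by simp
qed

section \<open>Gaps of clopen partitions\<close>

lemma part_gap_le_dist:
  assumes "card \<alpha> > 1" "A \<in> \<alpha>" "B \<in> \<alpha>" "A \<noteq> B" "x \<in> A" "y \<in> B"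
  shows "part_gap X \<alpha> \<le> dist x y"
proof -
  have "Inf {dist x y | x y A B. A \<in> \<alpha> \<and> B \<in> \<alpha> \<and> A \<noteq> B \<and> x \<in> A \<and> y \<in> B} \<le> dist x y"
    using assms(2-) by (intro cInf_lower bdd_belowI[of _ 0]) auto
  then show ?thesis
    using assms(1) by (simp add: part_gap_def)
qed

text \<open>By compactness the gap is attained, and its two points lie in disjoint blocks.
  Positivity is what later allows the monotonicity of \<open>ln\<close> to be applied to
  gaps.\<close>

lemma part_gap_pos:
  assumes "compact X" "clopen_partition X \<alpha>" "card \<alpha> > 1"
  shows "part_gap X \<alpha> > 0"
proof -
  obtain A B x y where "A \<in> \<alpha>" "B \<in> \<alpha>" "A \<noteq> B" "x \<in> A" "y \<in> B" "part_gap X \<alpha> = dist x y"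
    using part_gap_attained[OF assms] by blast
  moreover have "disjoint \<alpha>"
    using assms(2) by (simp add: clopen_partition_def partition_on_def)
  ultimately show ?thesis
    by (auto dest: disjointD)
qed

lemma card_restrict_partition_le:
  assumes "finite \<alpha>"
  shows "card (restrict_partition Y \<alpha>) \<le> card \<alpha>"
  unfolding restrict_partition_def
  by (meson assms card_Diff_subset_Int card_image_le card_mono Diff_subset finite_imageI order_trans)

text \<open>Points attaining the gap of the restriction lie in distinct traces, hence in distinct
  blocks of \<alpha>, so their distance competes in the infimum for \<open>X\<close>. With a single
  trace the gap would be \<open>diameter Y\<close>, to which this argument does not apply.\<close>

lemma part_gap_le_restrict:
  assumes "compact X" "clopen_partition X \<alpha>" "closedin (top_of_set X) Y"
    and card: "card (restrict_partition Y \<alpha>) > 1"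
  shows "part_gap X \<alpha> \<le> part_gap Y (restrict_partition Y \<alpha>)"
proof -
  have "compact Y" "Y \<subseteq> X"
    using assms(1,3) closedin_compact closedin_imp_subset by blast+
  then obtain A B x y where *: "A \<in> restrict_partition Y \<alpha>" "B \<in> restrict_partition Y \<alpha>" "A \<noteq> B"
      "x \<in> A" "y \<in> B" "part_gap Y (restrict_partition Y \<alpha>) = dist x y"
    using part_gap_attained[OF _ clopen_partition_restrict[OF assms(2)] card] by blast
  moreover obtain A' B' where "A' \<in> \<alpha>" "A = Y \<inter> A'" "B' \<in> \<alpha>" "B = Y \<inter> B'"
    using *(1,2) by (meson restrict_partitionE)
  moreover have "card \<alpha> > 1"
    using card card_restrict_partition_le[of \<alpha> Y] assms(2) by (simp add: clopen_partition_def)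
  ultimately show ?thesis
    using part_gap_le_dist[of \<alpha> A' B' x y X] by auto
qed

section \<open>Sign of the ratio and consequences of small diameter\<close>

lemma part_log_ratio_nonneg:
  assumes "compact X" "clopen_partition X \<alpha>"
  shows "0 \<le> part_log_ratio X \<alpha>"
proof -
  have "part_gap X \<alpha> \<ge> 0"
    using part_gap_pos[OF assms] diameter_ge_0[OF compact_imp_bounded[OF assms(1)]]
    by (cases "card \<alpha> > 1") (auto simp: part_gap_def[of X \<alpha>])
  then have "ln (part_gap X \<alpha>) \<le> 0" if "part_gap X \<alpha> < 1"
    \<comment> \<open>A zero gap, possible only with at most one block, is covered by the convention
      \<open>ln 0 = 0\<close>.\<close>
    using that by (cases "part_gap X \<alpha> = 0") auto
  moreover have "ln (part_diam \<alpha>) \<le> 0" if "part_diam \<alpha> < 1"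
    using that part_diam_nonneg[OF assms] by (cases "part_diam \<alpha> = 0") auto
  ultimately show ?thesis
    by (auto simp: part_log_ratio_def intro!: divide_nonpos_nonpos)
qed

text \<open>A block containing both \<open>p\<close> and \<open>q\<close> would have diameter at
  least \<open>dist p q\<close>.\<close>

lemma clopen_partition_separates:
  assumes "compact X" "clopen_partition X \<alpha>" "p \<in> X" "q \<in> X" "part_diam \<alpha> < dist p q"
  shows "card \<alpha> > 1" "part_gap X \<alpha> \<le> dist p q"
proof -
  have fin: "finite \<alpha>" and "\<Union>\<alpha> = X"
    using assms(2) by (auto simp: clopen_partition_def partition_on_def)
  then obtain A B where AB: "A \<in> \<alpha>" "p \<in> A" "B \<in> \<alpha>" "q \<in> B"
    using assms(3,4) by blast
  have "A \<noteq> B"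
  proof
    assume "A = B"
    then have "dist p q \<le> diameter A"
      using AB clopen_partition_bounded[OF assms(1,2)] by (intro diameter_bounded_bound) auto
    then show False
      using diameter_le_part_diam[OF assms(2) AB(1)] assms(5) by simp
  qed
  then show "card \<alpha> > 1"
    using fin AB by (metis One_nat_def card_le_Suc0_iff_eq not_less)
  then show "part_gap X \<alpha> \<le> dist p q"
    using AB \<open>A \<noteq> B\<close> by (intro part_gap_le_dist)
qed

text \<open>A block with two distinct points would have diameter at least 1, so every block has
  diameter 0.\<close>

lemma part_diam_eq_0:
  assumes "compact X" "clopen_partition X \<alpha>" "part_diam \<alpha> < 1"
    and sep: "\<And>p q. p \<in> X \<Longrightarrow> q \<in> X \<Longrightarrow> p \<noteq> q \<Longrightarrow> 1 \<le> dist p q"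
  shows "part_diam \<alpha> = 0"
proof -
  have "diameter A \<le> 0" if A: "A \<in> \<alpha>" for A
  proof -
    have "x = y" if xy: "x \<in> A" "y \<in> A" for x y
    proof (rule ccontr)
      assume "x \<noteq> y"
      moreover have "A \<subseteq> X"
        using assms(2) A by (auto simp: clopen_partition_def partition_on_def)
      ultimately have "1 \<le> dist x y"
        using sep xy by blast
      also have "\<dots> \<le> diameter A"
        using diameter_bounded_bound[OF clopen_partition_bounded[OF assms(1,2) A] xy] .
      finally show False
        using diameter_le_part_diam[OF assms(2) A] assms(3) by simp
    qed
    then have "A = {} \<or> (\<exists>x. A = {x})"
      by blast
    then show ?thesis
      by (auto simp: diameter_def)
  qed
  then have "part_diam \<alpha> \<le> 0"
    using part_diam_le[OF assms(2)] by simp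
  then show ?thesis
    using part_diam_nonneg[OF assms(1,2)] by simp
qed

section \<open>Comparison of logarithmic ratios\<close>

lemma ln_divide_ln_mono:
  fixes g g' d d' :: real
  assumes "0 < g" "g \<le> g'" "g' \<le> 1" "0 < d'" "d' \<le> d" "d < 1"
  shows "ln g' / ln d' \<le> ln g / ln d"
proof -
  \<comment> \<open>Negation makes the numerators nonnegative and the denominators positive; a
    larger gap shrinks the numerator and a smaller diameter enlarges the denominator.\<close>
  have "(- ln g') / (- ln d') \<le> (- ln g) / (- ln d)"
    using assms by (intro frac_le) auto
  then show ?thesis
    by simp
qed

lemma part_log_ratio_restrict_le:
  assumes "compact X" "clopen_partition X \<alpha>" "closedin (top_of_set X) Y"
    and "p \<in> Y" "q \<in> Y" "dist p q < 1" "part_diam \<alpha> < dist p q"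
  shows "part_log_ratio Y (restrict_partition Y \<alpha>) \<le> part_log_ratio X \<alpha>"
proof -
  define \<beta> where "\<beta> = restrict_partition Y \<alpha>"
  have Y: "compact Y" "Y \<subseteq> X"
    using assms(1,3) closedin_compact closedin_imp_subset by blast+
  have \<beta>: "clopen_partition Y \<beta>"
    unfolding \<beta>_def by (rule clopen_partition_restrict[OF assms(2) Y(2)])
  have diam: "part_diam \<beta> \<le> part_diam \<alpha>"
    unfolding \<beta>_def by (rule part_diam_restrict_le[OF assms(1,2) Y(2)])
  then have "part_diam \<beta> < dist p q"
    using assms(7) by simp
  \<comment> \<open>Separation inside \<open>Y\<close> gives \<beta> at least two blocks and bounds
    its gap by \<open>dist p q < 1\<close>.\<close>
  note sep = clopen_partition_separates[OF Y(1) \<beta> assms(4,5) this]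
  have gap: "part_gap X \<alpha> \<le> part_gap Y \<beta>"
    using part_gap_le_restrict[OF assms(1-3)] sep(1) by (simp add: \<beta>_def)
  have gap_pos: "part_gap X \<alpha> > 0"
    using clopen_partition_separates(1)[OF assms(1,2) _ _ assms(7)] assms(4,5) Y(2)
    by (intro part_gap_pos[OF assms(1,2)]) auto
  have "part_log_ratio Y \<beta> \<le> part_log_ratio X \<alpha>"
  proof (cases "part_diam \<beta> = 0")
    case True
    then show ?thesis
      using part_log_ratio_nonneg[OF assms(1,2)] by (simp add: part_log_ratio_def)
  next
    case False
    then have "part_diam \<beta> > 0"
      using part_diam_nonneg[OF Y(1) \<beta>] by simp
    \<comment> \<open>Both diameters lie strictly between 0 and 1 and both gaps are below 1, so both
      ratios are genuine quotients of logarithms.\<close>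
    then show ?thesis
      using diam gap gap_pos sep(2) assms(6,7)
      by (auto simp: part_log_ratio_def intro!: ln_divide_ln_mono)
  qed
  then show ?thesis
    by (simp add: \<beta>_def)
qed

section \<open>Passage to the infimum and the limit\<close>

lemma log_ratio_below_mono:
  assumes "compact X" "Y \<subseteq> X"
    and "\<And>\<alpha>. clopen_partition X \<alpha> \<Longrightarrow> part_diam \<alpha> < r \<Longrightarrow>
      part_log_ratio Y (restrict_partition Y \<alpha>) \<le> part_log_ratio X \<alpha>"
  shows "log_ratio_below Y r \<le> log_ratio_below X r"
  unfolding log_ratio_below_def[of X]
proof (rule Inf_greatest, clarify)
  fix \<alpha> assume \<alpha>: "clopen_partition X \<alpha>" "part_diam \<alpha> < r"
  then have "clopen_partition Y (restrict_partition Y \<alpha>)" "part_diam (restrict_partition Y \<alpha>) < r"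
    using clopen_partition_restrict part_diam_restrict_le[OF assms(1) \<alpha>(1) assms(2)] assms(2)
    by (auto intro: le_less_trans)
  \<comment> \<open>The restriction still has diameter below \<open>r\<close>, so it competes in the
    infimum for \<open>Y\<close>.\<close>
  then have "log_ratio_below Y r \<le> part_log_ratio Y (restrict_partition Y \<alpha>)"
    unfolding log_ratio_below_def by (intro Inf_lower) blast
  also have "\<dots> \<le> part_log_ratio X \<alpha>"
    using assms(3)[OF \<alpha>] .
  finally show "log_ratio_below Y r \<le> part_log_ratio X \<alpha>" .
qed

theorem proposition3p3:
  fixes X Y :: "'a::metric_space set"
  assumes "compact X"
    and "diameter X \<le> 1"
    and "closedin (top_of_set X) Y"
  shows "log_ratio Y \<le> log_ratio X"
proof -
  have Y: "compact Y" "Y \<subseteq> X"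
    using assms(1,3) closedin_compact closedin_imp_subset by blast+
  \<comment> \<open>The limit depends only on small \<open>r\<close>, so comparing ratios below some
    threshold \<open>s\<close> suffices: \<open>s = dist p q\<close> for a pair of distinct points
    of \<open>Y\<close> closer than 1, and \<open>s = 1\<close> if there is none.\<close>
  have "\<exists>s>0. \<forall>\<alpha>. clopen_partition X \<alpha> \<longrightarrow> part_diam \<alpha> < s \<longrightarrow>
      part_log_ratio Y (restrict_partition Y \<alpha>) \<le> part_log_ratio X \<alpha>"
  proof (cases "\<exists>p\<in>Y. \<exists>q\<in>Y. p \<noteq> q \<and> dist p q < 1")
    case True
    then obtain p q where "p \<in> Y" "q \<in> Y" "p \<noteq> q" "dist p q < 1"
      by blast
    then show ?thesis
      using part_log_ratio_restrict_le[OF assms(1) _ assms(3)]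
      by (intro exI[of _ "dist p q"]) auto
  next
    case False
    have "part_log_ratio Y (restrict_partition Y \<alpha>) \<le> part_log_ratio X \<alpha>"
      if \<alpha>: "clopen_partition X \<alpha>" "part_diam \<alpha> < 1" for \<alpha>
    proof -
      have "part_diam (restrict_partition Y \<alpha>) = 0"
        using False \<alpha>(2) part_diam_restrict_le[OF assms(1) \<alpha>(1) Y(2)]
        by (intro part_diam_eq_0[OF Y(1) clopen_partition_restrict[OF \<alpha>(1) Y(2)]])
          (auto simp: not_less)
      then show ?thesis
        using part_log_ratio_nonneg[OF assms(1) \<alpha>(1)] by (simp add: part_log_ratio_def)
    qed
    then show ?thesis
      by (intro exI[of _ 1]) auto
  qed
  then obtain s where "s > 0" and s: "\<And>\<alpha>. clopen_partition X \<alpha> \<Longrightarrow> part_diam \<alpha> < s \<Longrightarrow>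
      part_log_ratio Y (restrict_partition Y \<alpha>) \<le> part_log_ratio X \<alpha>"
    by blast
  have "log_ratio_below Y r \<le> log_ratio_below X r" if "r < s" for r
    using that s by (intro log_ratio_below_mono[OF assms(1) Y(2)]) auto
  then have "\<forall>\<^sub>F r in at_right 0. log_ratio_below Y r \<le> log_ratio_below X r"
    using \<open>s > 0\<close> by (auto simp: eventually_at_right_field)
  then show ?thesis
    using log_ratio_tendsto by (intro tendsto_le[OF trivial_limit_at_right_real])
qed

end
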